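(* Let $R$ be a commutative ring with identity, let $M$ be a Noetherian coreduced comultiplication $R$-module, and let $N$ be a non-zero submodule of $M$. Then the following are equivalent: (a) $N$ is a $dsz^\circ$-submodule of $M$; (b) $N$ is a sum of maximal second submodules of $M$; (c) $Ann_R(N)$ is a strong $z^\circ$-ideal of $R$; (d) for all submodules $K,H$ of $M$, $\mathfrak{S}_K=\mathfrak{S}_H$ and $N\subseteq K$ imply $N\subseteq H$; (e) for all submodules $K,H$ of $M$, $V^s(K)=V^s(H)$ and $N\subseteq K$ imply $N\subseteq H$; (f) for all submodules $K,H$ of $M$, $V^s(K)\subseteq V^s(H)$ and $N\subseteq K$ imply $N\subseteq H$; (g) for all submodules $K,H$ of $M$, $(K:_RM)=(H:_RM)$ and $N\subseteq K$ imply $N\subseteq H$; (h) for every submodule $K$ of $M$, $N\subseteq K$ implies $N\subseteq (K:_RM)M$.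
   Context: For a submodule $K$ of $M$, an ideal $I$ of $R$ and $r\in R$: $(K:_RM)=\{s\in R: sM\subseteq K\}$, $(K:_Mr)=\{m\in M: rm\in K\}$, $(0:_MI)=\{m\in M: Im=0\}$. $M$ is a comultiplication module if every submodule $N$ of $M$ has the form $N=(0:_MI)$ for some ideal $I$ of $R$. A proper submodule $L$ of $M$ is completely irreducible if $L=\bigcap_{i\in I}N_i$ for a family of submodules $N_i$ of $M$ implies $L=N_i$ for some $i$. $M$ is coreduced if for every $r\in R$ and every completely irreducible submodule $L$ of $M$, $(L:_Mr)=M$ implies $L+(0:_Mr)=M$. A non-zero submodule $S$ of $M$ is second if for each $a\in R$ multiplication by $a$ on $S$ is either surjective or zero. A maximal second submodule of $M$ is a second submodule of $M$ that is maximal under inclusion among the second submodules of $M$. For a submodule $K$ of $M$, $V^s(K)$ is the set of maximal second submodules of $M$ contained in $K$, and $\mathfrak{S}_K$ is the sum of all members of $V^s(K)$ (and $\mathfrak{S}_K=0$ if $V^s(K)=\emptyset$). A non-zero submodule $N$ of $M$ is a $dsz^\circ$-submodule of $M$ if $N\subseteq\mathfrak{S}_K$ for every submodule $K$ of $M$ with $N\subseteq K$. For an ideal $J$ of $R$, $\mathfrak{P}_J$ is the intersection of all minimal prime ideals of $R$ containing $J$ ($\mathfrak{P}_J=R$ if there are none). A proper ideal $I$ of $R$ is a strong $z^\circ$-ideal if $\mathfrak{P}_J\subseteq I$ for every ideal $J\subseteq I$.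
   Formalization: In 𝔓_J, "minimal prime ideals of R containing J" is taken to mean primes minimal among those containing J; if it meant minimal primes of R that contain J, (c) would fail for R = Z, M = N = Z/2Z, where (a) and (b) hold. *)

theory Defs
  imports Complex_Main "HOL-Algebra.Algebra"
begin

section \<open>Colons, annihilators and sums of submodules\<close>

definition colon_ring ::
    "('a, 'm) ring_scheme \<Rightarrow> ('a, 'b, 'n) module_scheme \<Rightarrow> 'b set \<Rightarrow> 'a set" where
  "colon_ring R M K = {s \<in> carrier R. \<forall>m \<in> carrier M. s \<odot>\<^bsub>M\<^esub> m \<in> K}"

definition colon_elem :: "('a, 'b, 'n) module_scheme \<Rightarrow> 'b set \<Rightarrow> 'a \<Rightarrow> 'b set" where
  "colon_elem M K r = {m \<in> carrier M. r \<odot>\<^bsub>M\<^esub> m \<in> K}"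

definition ann_in_module :: "('a, 'b, 'n) module_scheme \<Rightarrow> 'a set \<Rightarrow> 'b set" where
  "ann_in_module M I = {m \<in> carrier M. \<forall>r \<in> I. r \<odot>\<^bsub>M\<^esub> m = \<zero>\<^bsub>M\<^esub>}"

definition ann_in_ring ::
    "('a, 'm) ring_scheme \<Rightarrow> ('a, 'b, 'n) module_scheme \<Rightarrow> 'b set \<Rightarrow> 'a set" where
  "ann_in_ring R M N = {r \<in> carrier R. \<forall>n \<in> N. r \<odot>\<^bsub>M\<^esub> n = \<zero>\<^bsub>M\<^esub>}"

definition submodule_span ::
    "('a, 'm) ring_scheme \<Rightarrow> ('a, 'b, 'n) module_scheme \<Rightarrow> 'b set \<Rightarrow> 'b set" where
  "submodule_span R M A = (\<lambda>N. submodule N R M) hull A"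

text \<open>The empty family has sum \<open>{\<zero>\<^bsub>M\<^esub>}\<close>.\<close>

definition submodule_Sum ::
    "('a, 'm) ring_scheme \<Rightarrow> ('a, 'b, 'n) module_scheme \<Rightarrow> 'b set set \<Rightarrow> 'b set" where
  "submodule_Sum R M \<N> = submodule_span R M (\<Union>\<N>)"

definition ideal_smult ::
    "('a, 'm) ring_scheme \<Rightarrow> ('a, 'b, 'n) module_scheme \<Rightarrow> 'a set \<Rightarrow> 'b set" where
  "ideal_smult R M I = submodule_span R M {r \<odot>\<^bsub>M\<^esub> m | r m. r \<in> I \<and> m \<in> carrier M}"

section \<open>Conditions on the module\<close>

definition noetherian_module ::
    "('a, 'm) ring_scheme \<Rightarrow> ('a, 'b, 'n) module_scheme \<Rightarrow> bool" where
  "noetherian_module R M \<longleftrightarrow>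
     (\<forall>N. submodule N R M \<longrightarrow>
        (\<exists>A. finite A \<and> A \<subseteq> carrier M \<and> N = submodule_span R M A))"

definition comultiplication_module ::
    "('a, 'm) ring_scheme \<Rightarrow> ('a, 'b, 'n) module_scheme \<Rightarrow> bool" where
  "comultiplication_module R M \<longleftrightarrow>
     (\<forall>N. submodule N R M \<longrightarrow> (\<exists>I. ideal I R \<and> N = ann_in_module M I))"

text \<open>A family of submodules is represented by its set of members. The intersection with
  \<open>carrier M\<close> gives the empty family the intersection \<open>carrier M\<close>.\<close>

definition completely_irreducible ::
    "('a, 'm) ring_scheme \<Rightarrow> ('a, 'b, 'n) module_scheme \<Rightarrow> 'b set \<Rightarrow> bool" where
  "completely_irreducible R M L \<longleftrightarrow>
     submodule L R M \<and> L \<noteq> carrier M \<and>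
     (\<forall>\<N>. (\<forall>N \<in> \<N>. submodule N R M) \<longrightarrow> L = carrier M \<inter> \<Inter>\<N> \<longrightarrow> L \<in> \<N>)"

definition coreduced_module ::
    "('a, 'm) ring_scheme \<Rightarrow> ('a, 'b, 'n) module_scheme \<Rightarrow> bool" where
  "coreduced_module R M \<longleftrightarrow>
     (\<forall>r \<in> carrier R. \<forall>L. completely_irreducible R M L \<longrightarrow>
        colon_elem M L r = carrier M \<longrightarrow> L <+>\<^bsub>M\<^esub> colon_elem M {\<zero>\<^bsub>M\<^esub>} r = carrier M)"

section \<open>Second submodules and \<open>dsz\<degree>\<close>-submodules\<close>

definition second_submodule ::
    "('a, 'm) ring_scheme \<Rightarrow> ('a, 'b, 'n) module_scheme \<Rightarrow> 'b set \<Rightarrow> bool" where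
  "second_submodule R M S \<longleftrightarrow>
     submodule S R M \<and> S \<noteq> {\<zero>\<^bsub>M\<^esub>} \<and>
     (\<forall>a \<in> carrier R. (\<lambda>x. a \<odot>\<^bsub>M\<^esub> x) ` S = S \<or> (\<lambda>x. a \<odot>\<^bsub>M\<^esub> x) ` S = {\<zero>\<^bsub>M\<^esub>})"

definition maximal_second_submodule ::
    "('a, 'm) ring_scheme \<Rightarrow> ('a, 'b, 'n) module_scheme \<Rightarrow> 'b set \<Rightarrow> bool" where
  "maximal_second_submodule R M S \<longleftrightarrow>
     second_submodule R M S \<and> (\<forall>T. second_submodule R M T \<longrightarrow> S \<subseteq> T \<longrightarrow> T = S)"

definition maximal_seconds_in ::
    "('a, 'm) ring_scheme \<Rightarrow> ('a, 'b, 'n) module_scheme \<Rightarrow> 'b set \<Rightarrow> 'b set set" where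
  "maximal_seconds_in R M K = {S. maximal_second_submodule R M S \<and> S \<subseteq> K}"

definition maximal_second_sum ::
    "('a, 'm) ring_scheme \<Rightarrow> ('a, 'b, 'n) module_scheme \<Rightarrow> 'b set \<Rightarrow> 'b set" where
  "maximal_second_sum R M K = submodule_Sum R M (maximal_seconds_in R M K)"

definition dsz_submodule ::
    "('a, 'm) ring_scheme \<Rightarrow> ('a, 'b, 'n) module_scheme \<Rightarrow> 'b set \<Rightarrow> bool" where
  "dsz_submodule R M N \<longleftrightarrow>
     submodule N R M \<and> N \<noteq> {\<zero>\<^bsub>M\<^esub>} \<and>
     (\<forall>K. submodule K R M \<longrightarrow> N \<subseteq> K \<longrightarrow> N \<subseteq> maximal_second_sum R M K)"

section \<open>Strong \<open>z\<degree>\<close>-ideals\<close>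

text \<open>``Minimal prime ideals containing \<open>J\<close>'' are the primes that are minimal among those
  containing \<open>J\<close>. They need not be minimal primes of \<open>R\<close>: under that other reading of the
  phrase, with \<open>R = \<int>\<close> and \<open>M = N = \<int>/2\<int>\<close>, the annihilator \<open>2\<int>\<close> is not a strong
  \<open>z\<degree>\<close>-ideal, although \<open>N\<close> is a \<open>dsz\<degree>\<close>-submodule of the Noetherian coreduced
  comultiplication module \<open>M\<close>.\<close>

definition minimal_prime_containing :: "('a, 'm) ring_scheme \<Rightarrow> 'a set \<Rightarrow> 'a set \<Rightarrow> bool" where
  "minimal_prime_containing R J P \<longleftrightarrow>
     primeideal P R \<and> J \<subseteq> P \<and> (\<forall>Q. primeideal Q R \<longrightarrow> J \<subseteq> Q \<longrightarrow> Q \<subseteq> P \<longrightarrow> Q = P)"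

definition minimal_primes_Inter :: "('a, 'm) ring_scheme \<Rightarrow> 'a set \<Rightarrow> 'a set" where
  "minimal_primes_Inter R J = carrier R \<inter> \<Inter>{P. minimal_prime_containing R J P}"

definition strong_z_ideal :: "('a, 'm) ring_scheme \<Rightarrow> 'a set \<Rightarrow> bool" where
  "strong_z_ideal R I \<longleftrightarrow>
     ideal I R \<and> I \<noteq> carrier R \<and>
     (\<forall>J. ideal J R \<longrightarrow> J \<subseteq> I \<longrightarrow> minimal_primes_Inter R J \<subseteq> I)"

end

theory Submission
  imports Defs
begin

text \<open>
  Under the hypotheses every one of the eight conditions holds. Coreducedness gives
  \<open>M = rM + (0 :\<^sub>M r)\<close> for all \<open>r\<close>, the sum being direct since \<open>M\<close> is Noetherian. The
  comultiplication property then makes every submodule \<open>K\<close> equal to some \<open>(0 :\<^sub>M a)\<close> and to some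
  \<open>bM\<close>. So every submodule is a direct summand, \<open>K = (K :\<^sub>R M)M\<close>, every second submodule is
  minimal among the non-zero submodules, and \<open>K\<close> is the sum of the (automatically maximal) second
  submodules it contains. Finally \<open>Ann(N)\<close> is an intersection of primes \<open>Ann(S)\<close> with \<open>S\<close> second,
  and each of these contains a minimal prime over any ideal \<open>J \<subseteq> Ann(N)\<close>.
\<close>

text \<open>Induction on \<open>A\<close>: the member containing the smaller set and a member
  containing the new element are comparable, so the larger of the two contains both.\<close>

lemma subset_chain_finite_subset:
  assumes "finite A" and "C \<noteq> {}" and "subset.chain \<A> C" and "A \<subseteq> \<Union>C"
  shows "\<exists>Z\<in>C. A \<subseteq> Z"
  using assms(1,4)
proof (induction A)
  case empty
  then show ?case using assms(2) by auto
next
  case (insert x A)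
  then obtain Z Y where "Z \<in> C" "A \<subseteq> Z" "Y \<in> C" "x \<in> Y" by auto
  then show ?case using assms(3) unfolding subset_chain_def by (metis insert_subset subset_iff)
qed

section \<open>Minimal primes over an ideal\<close>

context cring
begin

text \<open>If \<open>a\<close> is missing from one member and \<open>b\<close> from another, the
  smaller of the two misses both, so primality of that single member rules out
  \<open>a \<otimes> b\<close>. This supplies the lower bounds of chains in the Zorn argument for
  minimal primes.\<close>

lemma primeideal_Inter_chain:
  assumes ne: "C \<noteq> {}" and prime: "\<And>P. P \<in> C \<Longrightarrow> primeideal P R"
    and ch: "\<And>P Q. P \<in> C \<Longrightarrow> Q \<in> C \<Longrightarrow> P \<subseteq> Q \<or> Q \<subseteq> P"
  shows "primeideal (\<Inter>C) R"
proof (rule primeidealI)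
  show "ideal (\<Inter>C) R"
    using i_Intersect[of C] ne prime primeideal.axioms(1) by blast
  show "cring R" by (rule is_cring)
  obtain P where "P \<in> C" using ne by blast
  then have "\<one> \<notin> P" using prime ideal.one_imp_carrier primeideal.I_notcarr primeideal.axioms(1) by metis
  then show "carrier R \<noteq> \<Inter>C" using \<open>P \<in> C\<close> one_closed by blast
  fix a b assume ab: "a \<in> carrier R" "b \<in> carrier R" "a \<otimes> b \<in> \<Inter>C"
  show "a \<in> \<Inter>C \<or> b \<in> \<Inter>C"
  proof (rule ccontr)
    assume "\<not> ?thesis"
    then obtain P Q where PQ: "P \<in> C" "a \<notin> P" "Q \<in> C" "b \<notin> Q" by blast
    then have "\<exists>T\<in>C. a \<notin> T \<and> b \<notin> T" using ch by blast
    then show False using ab prime primeideal.I_prime by (metis InterD)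
  qed
qed

lemma minimal_prime_containing_below:
  assumes P: "primeideal P R" and JP: "J \<subseteq> P"
  obtains Q where "minimal_prime_containing R J Q" and "Q \<subseteq> P"
proof -
  \<comment> \<open>Zorn's lemma is applied to complements: unions of chains become intersections of
    primes, and a maximal complement belongs to a minimal prime.\<close>
  define \<A> where "\<A> = uminus ` {Q. primeideal Q R \<and> J \<subseteq> Q \<and> Q \<subseteq> P}"
  have mem: "Z \<in> \<A> \<longleftrightarrow> primeideal (- Z) R \<and> J \<subseteq> - Z \<and> - Z \<subseteq> P" for Z
    unfolding \<A>_def by (auto simp: image_iff)
  have "\<exists>Z\<in>\<A>. \<forall>Y\<in>\<A>. Z \<subseteq> Y \<longrightarrow> Y = Z"
  proof (rule subset_Zorn_nonempty)
    show "\<A> \<noteq> {}" using assms unfolding \<A>_def by blast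
    fix C assume C: "C \<noteq> {}" "subset.chain \<A> C"
    have m: "Z \<in> \<A>" if "Z \<in> C" for Z using C that unfolding subset_chain_def by blast
    have "primeideal (\<Inter>(uminus ` C)) R"
    proof (rule primeideal_Inter_chain)
      show "uminus ` C \<noteq> {}" using C by blast
      show "primeideal Q R" if "Q \<in> uminus ` C" for Q using that m mem by blast
      show "Q \<subseteq> Q' \<or> Q' \<subseteq> Q" if "Q \<in> uminus ` C" "Q' \<in> uminus ` C" for Q Q'
        using that C unfolding subset_chain_def by blast
    qed
    moreover have "- \<Union>C = \<Inter>(uminus ` C)" by blast
    moreover have "J \<subseteq> - \<Union>C" "- \<Union>C \<subseteq> P" using C(1) m mem by blast+
    ultimately show "\<Union>C \<in> \<A>" by (simp add: mem)
  qed
  then obtain Z where Z: "Z \<in> \<A>" "\<And>Y. Y \<in> \<A> \<Longrightarrow> Z \<subseteq> Y \<Longrightarrow> Y = Z" by blast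
  have "Q = - Z" if "primeideal Q R" "J \<subseteq> Q" "Q \<subseteq> - Z" for Q
  proof -
    have "- Q \<in> \<A>" using that Z(1) by (auto simp: mem)
    then show ?thesis using Z(2)[of "- Q"] that by blast
  qed
  then show thesis using that[of "- Z"] Z(1) by (simp add: mem minimal_prime_containing_def)
qed

end

section \<open>Sums, images, spans and chains of submodules\<close>

context module
begin

lemma submodule_carrier: "submodule K R M \<Longrightarrow> x \<in> K \<Longrightarrow> x \<in> carrier M"
  using submoduleE(1) by blast

lemma submodule_zero: "submodule K R M \<Longrightarrow> \<zero>\<^bsub>M\<^esub> \<in> K"
  using submoduleE[of K] by (metis M.r_neg ex_in_conv subsetD)

lemma submodule_minus: "submodule K R M \<Longrightarrow> x \<in> K \<Longrightarrow> y \<in> K \<Longrightarrow> x \<ominus>\<^bsub>M\<^esub> y \<in> K"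
  by (simp add: a_minus_def submoduleE)

lemma zero_submodule: "submodule {\<zero>\<^bsub>M\<^esub>} R M"
  by (rule submoduleI) auto

text \<open>Nonemptiness keeps the intersection inside \<open>carrier M\<close>, since
  \<open>\<Inter>{}\<close> is the whole type.\<close>

lemma submodule_Inter:
  assumes "\<N> \<noteq> {}" and "\<And>N. N \<in> \<N> \<Longrightarrow> submodule N R M"
  shows "submodule (\<Inter>\<N>) R M"
proof (rule submoduleI)
  show "\<Inter>\<N> \<subseteq> carrier M" using assms submodule_carrier by blast
qed (use assms in \<open>auto intro: submodule_zero submoduleE\<close>)

lemma submodule_Int: "submodule K R M \<Longrightarrow> submodule L R M \<Longrightarrow> submodule (K \<inter> L) R M"
  using submodule_Inter[of "{K, L}"] by auto

lemma submodule_Union_chain: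
  assumes "C \<noteq> {}" and "subset.chain {N. submodule N R M} C"
  shows "submodule (\<Union>C) R M"
proof -
  have sub: "submodule N R M" if "N \<in> C" for N using assms that unfolding subset_chain_def by blast
  show ?thesis
  proof (rule submoduleI)
    show "\<Union>C \<subseteq> carrier M" using sub submodule_carrier by blast
    show "\<zero>\<^bsub>M\<^esub> \<in> \<Union>C" using assms(1) sub submodule_zero by blast
    show "a \<oplus>\<^bsub>M\<^esub> b \<in> \<Union>C" if ab: "a \<in> \<Union>C" "b \<in> \<Union>C" for a b
    proof -
      obtain Z where "Z \<in> C" "{a, b} \<subseteq> Z"
        using subset_chain_finite_subset[OF _ assms, of "{a, b}"] ab by auto
      then show ?thesis using sub submoduleE(5) by blast
    qed
  qed (use sub submoduleE in blast)+
qed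

lemma set_addI: "k \<in> K \<Longrightarrow> l \<in> L \<Longrightarrow> k \<oplus>\<^bsub>M\<^esub> l \<in> K <+>\<^bsub>M\<^esub> L"
  by (auto simp: set_add_def')

lemma submodule_add:
  assumes K: "submodule K R M" and L: "submodule L R M"
  shows "submodule (K <+>\<^bsub>M\<^esub> L) R M"
proof (rule submoduleI)
  note c = submodule_carrier[OF K] submodule_carrier[OF L]
  show "K <+>\<^bsub>M\<^esub> L \<subseteq> carrier M" using c by (auto simp: set_add_def')
  show "\<zero>\<^bsub>M\<^esub> \<in> K <+>\<^bsub>M\<^esub> L"
    using set_addI[OF submodule_zero[OF K] submodule_zero[OF L]] by simp
  show "\<ominus>\<^bsub>M\<^esub> a \<in> K <+>\<^bsub>M\<^esub> L" if a: "a \<in> K <+>\<^bsub>M\<^esub> L" for a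
  proof -
    obtain k l where e: "a = k \<oplus>\<^bsub>M\<^esub> l" "k \<in> K" "l \<in> L" using a unfolding set_add_def' by auto
    then have "\<ominus>\<^bsub>M\<^esub> a = \<ominus>\<^bsub>M\<^esub> k \<oplus>\<^bsub>M\<^esub> \<ominus>\<^bsub>M\<^esub> l" using c by (simp add: M.minus_add)
    then show ?thesis using e submoduleE(3)[OF K] submoduleE(3)[OF L] by (simp add: set_addI)
  qed
  show "a \<oplus>\<^bsub>M\<^esub> b \<in> K <+>\<^bsub>M\<^esub> L" if ab: "a \<in> K <+>\<^bsub>M\<^esub> L" "b \<in> K <+>\<^bsub>M\<^esub> L" for a b
  proof -
    obtain k l k' l' where e: "a = k \<oplus>\<^bsub>M\<^esub> l" "b = k' \<oplus>\<^bsub>M\<^esub> l'" "k \<in> K" "k' \<in> K" "l \<in> L" "l' \<in> L"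
      using ab unfolding set_add_def' by auto
    then have "a \<oplus>\<^bsub>M\<^esub> b = (k \<oplus>\<^bsub>M\<^esub> k') \<oplus>\<^bsub>M\<^esub> (l \<oplus>\<^bsub>M\<^esub> l')" using c by (simp add: M.a_ac)
    then show ?thesis using e submoduleE(5)[OF K] submoduleE(5)[OF L] by (simp add: set_addI)
  qed
  show "r \<odot>\<^bsub>M\<^esub> x \<in> K <+>\<^bsub>M\<^esub> L" if r: "r \<in> carrier R" and x: "x \<in> K <+>\<^bsub>M\<^esub> L" for r x
  proof -
    obtain k l where e: "x = k \<oplus>\<^bsub>M\<^esub> l" "k \<in> K" "l \<in> L" using x unfolding set_add_def' by auto
    then have "r \<odot>\<^bsub>M\<^esub> x = r \<odot>\<^bsub>M\<^esub> k \<oplus>\<^bsub>M\<^esub> r \<odot>\<^bsub>M\<^esub> l" using c r by (simp add: smult_r_distr)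
    then show ?thesis
      using e submoduleE(4)[OF K r] submoduleE(4)[OF L r] by (simp add: set_addI)
  qed
qed

lemma set_add_upper:
  assumes "submodule K R M" and "submodule L R M"
  shows "K \<subseteq> K <+>\<^bsub>M\<^esub> L" and "L \<subseteq> K <+>\<^bsub>M\<^esub> L"
proof -
  show "K \<subseteq> K <+>\<^bsub>M\<^esub> L"
  proof
    fix k assume "k \<in> K"
    then have "k = k \<oplus>\<^bsub>M\<^esub> \<zero>\<^bsub>M\<^esub>" using assms submodule_carrier by simp
    then show "k \<in> K <+>\<^bsub>M\<^esub> L" using set_addI[OF \<open>k \<in> K\<close> submodule_zero[OF assms(2)]] by simp
  qed
  show "L \<subseteq> K <+>\<^bsub>M\<^esub> L"
  proof
    fix l assume "l \<in> L"
    then have "l = \<zero>\<^bsub>M\<^esub> \<oplus>\<^bsub>M\<^esub> l" using assms submodule_carrier by simp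
    then show "l \<in> K <+>\<^bsub>M\<^esub> L" using set_addI[OF submodule_zero[OF assms(1)] \<open>l \<in> L\<close>] by simp
  qed
qed

lemma smult_image_submodule:
  assumes K: "submodule K R M" and r: "r \<in> carrier R"
  shows "submodule ((\<lambda>m. r \<odot>\<^bsub>M\<^esub> m) ` K) R M"
proof (rule submoduleI)
  note c = submodule_carrier[OF K]
  show "(\<lambda>m. r \<odot>\<^bsub>M\<^esub> m) ` K \<subseteq> carrier M" using c r by auto
  show "\<zero>\<^bsub>M\<^esub> \<in> (\<lambda>m. r \<odot>\<^bsub>M\<^esub> m) ` K" using submodule_zero[OF K] r by (metis imageI smult_r_null)
  show "\<ominus>\<^bsub>M\<^esub> a \<in> (\<lambda>m. r \<odot>\<^bsub>M\<^esub> m) ` K" if "a \<in> (\<lambda>m. r \<odot>\<^bsub>M\<^esub> m) ` K" for a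
    using that r c submoduleE(3)[OF K] by (auto simp: smult_r_minus[symmetric])
  show "a \<oplus>\<^bsub>M\<^esub> b \<in> (\<lambda>m. r \<odot>\<^bsub>M\<^esub> m) ` K"
    if "a \<in> (\<lambda>m. r \<odot>\<^bsub>M\<^esub> m) ` K" "b \<in> (\<lambda>m. r \<odot>\<^bsub>M\<^esub> m) ` K" for a b
    using that r c submoduleE(5)[OF K] by (auto simp: smult_r_distr[symmetric])
  show "s \<odot>\<^bsub>M\<^esub> x \<in> (\<lambda>m. r \<odot>\<^bsub>M\<^esub> m) ` K"
    if s: "s \<in> carrier R" and x: "x \<in> (\<lambda>m. r \<odot>\<^bsub>M\<^esub> m) ` K" for s x
  proof -
    obtain m where m: "m \<in> K" "x = r \<odot>\<^bsub>M\<^esub> m" using x by blast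
    then have "s \<odot>\<^bsub>M\<^esub> x = r \<odot>\<^bsub>M\<^esub> (s \<odot>\<^bsub>M\<^esub> m)"
      using s r c by (metis R.m_comm smult_assoc1)
    then show ?thesis using m s submoduleE(4)[OF K] by blast
  qed
qed

lemma smult_comm:
  "r \<in> carrier R \<Longrightarrow> s \<in> carrier R \<Longrightarrow> x \<in> carrier M \<Longrightarrow>
    r \<odot>\<^bsub>M\<^esub> (s \<odot>\<^bsub>M\<^esub> x) = s \<odot>\<^bsub>M\<^esub> (r \<odot>\<^bsub>M\<^esub> x)"
  by (metis R.m_comm smult_assoc1)

lemma colon_elem_submodule:
  assumes K: "submodule K R M" and r: "r \<in> carrier R"
  shows "submodule (colon_elem M K r) R M"
proof (rule submoduleI)
  show "s \<odot>\<^bsub>M\<^esub> x \<in> colon_elem M K r" if "s \<in> carrier R" "x \<in> colon_elem M K r" for s x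
    using that r submoduleE(4)[OF K] smult_comm[of r s x] by (simp add: colon_elem_def)
qed (use r submodule_zero[OF K] submoduleE(3,5)[OF K] in
  \<open>auto simp: colon_elem_def smult_r_minus smult_r_distr\<close>)

text \<open>As \<open>A\<close> lies in \<open>carrier M\<close>, the carrier itself is one of the
  submodules intersected by the hull, so the intersection is over a nonempty family.\<close>

lemma submodule_span_submodule:
  assumes "A \<subseteq> carrier M" shows "submodule (submodule_span R M A) R M"
  unfolding submodule_span_def hull_def
  using assms carrier_is_submodule by (intro submodule_Inter) auto

lemma submodule_span_least: "submodule K R M \<Longrightarrow> A \<subseteq> K \<Longrightarrow> submodule_span R M A \<subseteq> K"
  unfolding submodule_span_def by (simp add: hull_minimal)

lemma submodule_span_upper: "A \<subseteq> submodule_span R M A"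
  unfolding submodule_span_def by (rule hull_subset)

text \<open>The union of a chain is a finitely generated submodule. Its generators already lie in
  one member of the chain, which therefore equals the union, and Zorn's lemma applies.\<close>

lemma noetherian_module_has_maximal:
  assumes noeth: "noetherian_module R M" and ne: "\<A> \<noteq> {}"
    and sub: "\<And>N. N \<in> \<A> \<Longrightarrow> submodule N R M"
  obtains N where "N \<in> \<A>" and "\<And>Z. Z \<in> \<A> \<Longrightarrow> N \<subseteq> Z \<Longrightarrow> Z = N"
proof -
  have "\<exists>N\<in>\<A>. \<forall>Z\<in>\<A>. N \<subseteq> Z \<longrightarrow> Z = N"
  proof (rule subset_Zorn_nonempty[OF ne])
    fix C assume C: "C \<noteq> {}" "subset.chain \<A> C"
    have CA: "C \<subseteq> \<A>" using C(2) by (simp add: subset_chain_def)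
    have "submodule (\<Union>C) R M"
      using C sub by (intro submodule_Union_chain) (auto simp: subset_chain_def)
    then obtain A where A: "finite A" "\<Union>C = submodule_span R M A"
      using noeth unfolding noetherian_module_def by blast
    then obtain Z where Z: "Z \<in> C" "A \<subseteq> Z"
      using subset_chain_finite_subset[OF A(1) C] submodule_span_upper by auto
    then have "\<Union>C = Z" using A(2) submodule_span_least[of Z A] sub CA by blast
    then show "\<Union>C \<in> \<A>" using Z CA by blast
  qed
  then show thesis using that by blast
qed

end

section \<open>Range and kernel of multiplication by a ring element\<close>

locale noetherian_coreduced_comultiplication_module = module R M
  for R :: "('a, 'm) ring_scheme" (structure) and M :: "('a, 'b, 'n) module_scheme" (structure) +
  assumes noetherian: "noetherian_module R M"
    and coreduced: "coreduced_module R M"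
    and comultiplication: "comultiplication_module R M"
begin

abbreviation smult_range :: "'a \<Rightarrow> 'b set"
  where "smult_range r \<equiv> (\<lambda>m. r \<odot>\<^bsub>M\<^esub> m) ` carrier M"

abbreviation smult_kernel :: "'a \<Rightarrow> 'b set"
  where "smult_kernel r \<equiv> colon_elem M {\<zero>\<^bsub>M\<^esub>} r"

lemma smult_range_submodule: "r \<in> carrier R \<Longrightarrow> submodule (smult_range r) R M"
  by (simp add: carrier_is_submodule smult_image_submodule)

lemma smult_kernel_submodule: "r \<in> carrier R \<Longrightarrow> submodule (smult_kernel r) R M"
  by (simp add: colon_elem_submodule zero_submodule)

lemma smult_kernel_iff: "x \<in> smult_kernel r \<longleftrightarrow> x \<in> carrier M \<and> r \<odot>\<^bsub>M\<^esub> x = \<zero>\<^bsub>M\<^esub>"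
  by (simp add: colon_elem_def)

text \<open>If the sum missed some \<open>x\<close>, a submodule \<open>L\<close> maximal among
  those containing the sum and avoiding \<open>x\<close> would be completely irreducible. It
  contains rM, so coreducedness gives L + (0 : r) = M; but \<open>L\<close> also contains (0 : r),
  so it would be all of M.\<close>

lemma smult_range_add_kernel:
  assumes r: "r \<in> carrier R"
  shows "smult_range r <+>\<^bsub>M\<^esub> smult_kernel r = carrier M"
proof (rule ccontr)
  define H where "H = smult_range r <+>\<^bsub>M\<^esub> smult_kernel r"
  note sub = smult_range_submodule[OF r] smult_kernel_submodule[OF r]
  have H: "submodule H R M" unfolding H_def using sub by (rule submodule_add)
  assume "smult_range r <+>\<^bsub>M\<^esub> smult_kernel r \<noteq> carrier M"
  then obtain x where x: "x \<in> carrier M" "x \<notin> H" using submodule_carrier[OF H] H_def by blast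
  define \<A> where "\<A> = {L. submodule L R M \<and> H \<subseteq> L \<and> x \<notin> L}"
  obtain L where L: "L \<in> \<A>" and Lmax: "\<And>Z. Z \<in> \<A> \<Longrightarrow> L \<subseteq> Z \<Longrightarrow> Z = L"
    using noetherian_module_has_maximal[OF noetherian, of \<A>] x H unfolding \<A>_def by blast
  have "completely_irreducible R M L"
    unfolding completely_irreducible_def
  proof (intro conjI allI impI)
    show "submodule L R M" "L \<noteq> carrier M" using L x by (auto simp: \<A>_def)
    fix \<N> assume sub: "\<forall>N\<in>\<N>. submodule N R M" and eq: "L = carrier M \<inter> \<Inter>\<N>"
    \<comment> \<open>Some member of the family must avoid \<open>x\<close>, since \<open>L\<close>
      does. It contains \<open>L\<close>, so maximality makes it equal to \<open>L\<close>.\<close>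
    then obtain N where N: "N \<in> \<N>" "x \<notin> N" using L x by (auto simp: \<A>_def)
    then have "N \<in> \<A>" "L \<subseteq> N" using L sub eq by (auto simp: \<A>_def)
    then show "L \<in> \<N>" using Lmax N by blast
  qed
  moreover have up: "smult_range r \<subseteq> L" "smult_kernel r \<subseteq> L"
    using set_add_upper[OF sub] L by (auto simp: \<A>_def H_def)
  then have "colon_elem M L r = carrier M" by (auto simp: colon_elem_def)
  ultimately have "L <+>\<^bsub>M\<^esub> smult_kernel r = carrier M"
    using coreduced r by (simp add: coreduced_module_def)
  moreover have "L <+>\<^bsub>M\<^esub> smult_kernel r \<subseteq> L"
    using up(2) L submoduleE(5)[of L] by (auto simp: set_add_def' \<A>_def)
  ultimately show False using L x by (auto simp: \<A>_def)
qed

lemma smult_range_kernelE: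
  assumes "r \<in> carrier R" and "x \<in> carrier M"
  obtains m z where "m \<in> carrier M" "z \<in> smult_kernel r" "x = r \<odot>\<^bsub>M\<^esub> m \<oplus>\<^bsub>M\<^esub> z"
  using smult_range_add_kernel[OF assms(1)] assms(2) unfolding set_add_def' by blast

text \<open>Multiplying a decomposition m = rm' + z by \<open>r\<close> kills \<open>z\<close>;
  hence \<open>r\<close> maps rM onto itself.\<close>

lemma smult_range_square:
  assumes r: "r \<in> carrier R" and m: "m \<in> carrier M"
  obtains m' where "m' \<in> carrier M" "r \<odot>\<^bsub>M\<^esub> m = r \<odot>\<^bsub>M\<^esub> (r \<odot>\<^bsub>M\<^esub> m')"
proof -
  obtain m' z where "m' \<in> carrier M" "z \<in> smult_kernel r" "m = r \<odot>\<^bsub>M\<^esub> m' \<oplus>\<^bsub>M\<^esub> z"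
    using smult_range_kernelE[OF r m] .
  then show thesis using that[of m'] r by (simp add: smult_kernel_iff smult_r_distr)
qed

text \<open>\<open>r\<close> maps rM onto itself, and a surjective endomorphism of a Noetherian
  module is injective. With \<open>smult_range_add_kernel\<close> this makes M the direct sum of rM
  and (0 : r).\<close>

lemma smult_range_Int_kernel:
  assumes r: "r \<in> carrier R" and x: "x \<in> smult_range r" "x \<in> smult_kernel r"
  shows "x = \<zero>\<^bsub>M\<^esub>"
proof -
  \<comment> \<open>Replaces the ascending chain \<open>(0 :\<^sub>M r) \<subseteq> (0 :\<^sub>M r\<^sup>2) \<subseteq> \<dots>\<close>: all powers \<open>s\<close> of \<open>r\<close> have the
    same range.\<close>
  define \<A> where "\<A> = smult_kernel ` {s \<in> carrier R. smult_range s = smult_range r}"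
  have ne: "\<A> \<noteq> {}" using r by (auto simp: \<A>_def)
  have sub: "submodule N R M" if "N \<in> \<A>" for N
    using that smult_kernel_submodule by (auto simp: \<A>_def)
  obtain N where "N \<in> \<A>" and max: "\<And>Z. Z \<in> \<A> \<Longrightarrow> N \<subseteq> Z \<Longrightarrow> Z = N"
    using noetherian_module_has_maximal[OF noetherian ne sub] by blast
  then obtain s where s: "s \<in> carrier R" "smult_range s = smult_range r" "N = smult_kernel s"
    by (auto simp: \<A>_def)
  \<comment> \<open>Multiplying \<open>s\<close> by \<open>r\<close> keeps it in the family: r(sM) =
    r(rM) = rM. Maximality then forces the kernels of \<open>s\<close> and
    \<open>r \<otimes> s\<close> to agree.\<close>
  have "smult_range (r \<otimes> s) = (\<lambda>m. r \<odot>\<^bsub>M\<^esub> m) ` smult_range s"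
    unfolding image_image using r s(1) by (intro image_cong) (simp_all add: smult_assoc1)
  also have "\<dots> = smult_range r"
  proof
    show "(\<lambda>m. r \<odot>\<^bsub>M\<^esub> m) ` smult_range s \<subseteq> smult_range r" using r s by auto
    show "smult_range r \<subseteq> (\<lambda>m. r \<odot>\<^bsub>M\<^esub> m) ` smult_range s"
      unfolding s(2) using smult_range_square[OF r] by blast
  qed
  finally have "smult_kernel (r \<otimes> s) \<in> \<A>" using r s by (auto simp: \<A>_def)
  moreover have "N \<subseteq> smult_kernel (r \<otimes> s)"
    using r s by (auto simp: smult_kernel_iff smult_assoc1)
  ultimately have eq: "smult_kernel (r \<otimes> s) = smult_kernel s" using max s by blast
  \<comment> \<open>As sM = rM, \<open>x\<close> can be written as sm. Then rx = 0 puts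
    \<open>m\<close> in the kernel of \<open>r \<otimes> s\<close>, hence in that of
    \<open>s\<close>, so x = sm = 0.\<close>
  obtain m where m: "m \<in> carrier M" "x = s \<odot>\<^bsub>M\<^esub> m" using x s by blast
  then have "m \<in> smult_kernel (r \<otimes> s)" using x r s by (simp add: smult_kernel_iff smult_assoc1)
  then show ?thesis using eq m by (simp add: smult_kernel_iff)
qed

section \<open>Every submodule as a kernel and as a range\<close>

lemma submodule_eq_annihilated:
  assumes "submodule K R M"
  obtains I where "ideal I R" "K = ann_in_module M I"
  using comultiplication assms unfolding comultiplication_module_def by blast

text \<open>Write \<open>K\<close> as the annihilator of an ideal \<open>A\<close> and choose
  \<open>a\<close> in \<open>A\<close> with aM maximal. Whatever \<open>a\<close> kills is then
  killed by all of \<open>A\<close>, since otherwise \<open>a\<close> could be modified inside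
  \<open>A\<close> to enlarge its range.\<close>

lemma submodule_eq_smult_kernel:
  assumes K: "submodule K R M"
  obtains a where "a \<in> carrier R" "K = smult_kernel a"
proof -
  obtain A where A: "ideal A R" and KA: "K = ann_in_module M A"
    using submodule_eq_annihilated[OF K] .
  interpret A: ideal A R by fact
  define \<A> where "\<A> = smult_range ` A"
  have ne: "\<A> \<noteq> {}" using A.zero_closed unfolding \<A>_def by blast
  have sub: "submodule N R M" if "N \<in> \<A>" for N
    using that smult_range_submodule A.Icarr by (auto simp: \<A>_def)
  obtain N where "N \<in> \<A>" and max: "\<And>Z. Z \<in> \<A> \<Longrightarrow> N \<subseteq> Z \<Longrightarrow> Z = N"
    using noetherian_module_has_maximal[OF noetherian ne sub] by blast
  then obtain a where a: "a \<in> A" and N: "N = smult_range a" by (auto simp: \<A>_def)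
  have aR: "a \<in> carrier R" using a by (rule A.Icarr)
  have "b \<odot>\<^bsub>M\<^esub> y = \<zero>\<^bsub>M\<^esub>" if b: "b \<in> A" and y: "y \<in> smult_kernel a" for b y
  proof (rule ccontr)
    assume nz: "b \<odot>\<^bsub>M\<^esub> y \<noteq> \<zero>\<^bsub>M\<^esub>"
    have bR: "b \<in> carrier R" using b by (rule A.Icarr)
    have yM: "y \<in> carrier M" and ay: "a \<odot>\<^bsub>M\<^esub> y = \<zero>\<^bsub>M\<^esub>" using y by (simp_all add: smult_kernel_iff)
    have "b \<odot>\<^bsub>M\<^esub> y \<in> smult_kernel a"
      using aR bR yM ay smult_comm[of a b y] by (simp add: smult_kernel_iff)
    then have notin: "b \<odot>\<^bsub>M\<^esub> y \<notin> smult_range a" using smult_range_Int_kernel[OF aR] nz by blast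
    \<comment> \<open>The comultiplication property is used a second time, now for aM: an element
      outside aM is detected by some \<open>t\<close> that annihilates aM.\<close>
    obtain I where I: "ideal I R" and aI: "smult_range a = ann_in_module M I"
      using submodule_eq_annihilated[OF smult_range_submodule[OF aR]] .
    obtain t where t: "t \<in> I" and tby: "t \<odot>\<^bsub>M\<^esub> (b \<odot>\<^bsub>M\<^esub> y) \<noteq> \<zero>\<^bsub>M\<^esub>"
      using notin bR yM unfolding aI by (auto simp: ann_in_module_def)
    have tR: "t \<in> carrier R" using t I ideal.Icarr by metis
    have ta: "t \<odot>\<^bsub>M\<^esub> (a \<odot>\<^bsub>M\<^esub> m) = \<zero>\<^bsub>M\<^esub>" if "m \<in> carrier M" for m
    proof -
      have "a \<odot>\<^bsub>M\<^esub> m \<in> ann_in_module M I" using that aI by blast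
      then show ?thesis using t by (simp add: ann_in_module_def)
    qed
    \<comment> \<open>\<open>t\<close> kills \<open>aM\<close> but not \<open>by\<close>, so \<open>cM\<close> contains \<open>a(aM) = aM\<close> and also \<open>tby \<notin> aM\<close>,
      contradicting the maximality of \<open>aM\<close>.\<close>
    define c where "c = a \<oplus> t \<otimes> b"
    have c: "c \<in> A" unfolding c_def using a b tR by (simp add: A.I_l_closed)
    have cm: "c \<odot>\<^bsub>M\<^esub> m = a \<odot>\<^bsub>M\<^esub> m \<oplus>\<^bsub>M\<^esub> t \<odot>\<^bsub>M\<^esub> (b \<odot>\<^bsub>M\<^esub> m)" if "m \<in> carrier M" for m
      unfolding c_def using that aR bR tR by (simp add: smult_l_distr smult_assoc1)
    have "smult_range a \<subseteq> smult_range c"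
    proof
      fix x assume "x \<in> smult_range a"
      then obtain m where m: "m \<in> carrier M" "x = a \<odot>\<^bsub>M\<^esub> (a \<odot>\<^bsub>M\<^esub> m)"
        using smult_range_square[OF aR] by blast
      have "t \<odot>\<^bsub>M\<^esub> (b \<odot>\<^bsub>M\<^esub> (a \<odot>\<^bsub>M\<^esub> m)) = \<zero>\<^bsub>M\<^esub>"
        using smult_comm[of b a m] aR bR ta m(1) by simp
      then have "c \<odot>\<^bsub>M\<^esub> (a \<odot>\<^bsub>M\<^esub> m) = x" using cm[of "a \<odot>\<^bsub>M\<^esub> m"] m aR by simp
      then show "x \<in> smult_range c" using m(1) aR by (metis imageI smult_closed)
    qed
    moreover have "smult_range c \<in> \<A>" using c unfolding \<A>_def by (rule imageI)
    ultimately have "smult_range c = smult_range a" using max N by blast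
    moreover have "c \<odot>\<^bsub>M\<^esub> y = t \<odot>\<^bsub>M\<^esub> (b \<odot>\<^bsub>M\<^esub> y)" using cm[OF yM] ay tR bR yM by simp
    ultimately have "t \<odot>\<^bsub>M\<^esub> (b \<odot>\<^bsub>M\<^esub> y) \<in> smult_range a" using yM by (metis imageI)
    moreover have "t \<odot>\<^bsub>M\<^esub> (b \<odot>\<^bsub>M\<^esub> y) \<in> smult_kernel a"
      using \<open>b \<odot>\<^bsub>M\<^esub> y \<in> smult_kernel a\<close> smult_kernel_submodule[OF aR] tR submoduleE(4) by blast
    ultimately show False using smult_range_Int_kernel[OF aR] tby by blast
  qed
  then have "K = smult_kernel a"
    using a unfolding KA by (auto simp: ann_in_module_def smult_kernel_iff)
  then show thesis using that aR by blast
qed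

text \<open>Let \<open>K\<close> be the kernel of \<open>a\<close>, and aM the kernel of
  \<open>b\<close>. Since ba = 0 on M, bM lies in \<open>K\<close>. Conversely, decompose
  \<open>k\<close> in \<open>K\<close> as bm + z with bz = 0: then \<open>z\<close> lies in aM and
  in \<open>K\<close>, hence in the zero intersection of range and kernel of
  \<open>a\<close>.\<close>

lemma submodule_eq_smult_range:
  assumes K: "submodule K R M"
  obtains b where "b \<in> carrier R" "K = smult_range b"
proof -
  obtain a where a: "a \<in> carrier R" "K = smult_kernel a" using submodule_eq_smult_kernel[OF K] .
  obtain b where b: "b \<in> carrier R" "smult_range a = smult_kernel b"
    using submodule_eq_smult_kernel[OF smult_range_submodule[OF a(1)]] .
  have ba: "b \<odot>\<^bsub>M\<^esub> (a \<odot>\<^bsub>M\<^esub> m) = \<zero>\<^bsub>M\<^esub>" if "m \<in> carrier M" for m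
    using that b(2) smult_kernel_iff by blast
  have le: "smult_range b \<subseteq> K"
    using a b ba smult_comm[of a b] by (auto simp: smult_kernel_iff)
  moreover have "K \<subseteq> smult_range b"
  proof
    fix k assume k: "k \<in> K"
    have kM: "k \<in> carrier M" using K k by (rule submodule_carrier)
    obtain m z where mz: "m \<in> carrier M" "z \<in> smult_kernel b" "k = b \<odot>\<^bsub>M\<^esub> m \<oplus>\<^bsub>M\<^esub> z"
      using smult_range_kernelE[OF b(1) kM] .
    have zM: "z \<in> carrier M" using mz(2) by (simp add: smult_kernel_iff)
    have bm: "b \<odot>\<^bsub>M\<^esub> m \<in> K" using le mz(1) by blast
    have "z = k \<ominus>\<^bsub>M\<^esub> b \<odot>\<^bsub>M\<^esub> m"
      using mz zM b by (simp add: a_minus_def M.a_ac M.r_neg2 M.r_neg)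
    then have "z \<in> K" using submodule_minus[OF K k bm] by simp
    then have "z = \<zero>\<^bsub>M\<^esub>" using smult_range_Int_kernel[OF a(1)] a(2) b(2) mz(2) by blast
    then show "k \<in> smult_range b" using mz b by simp
  qed
  ultimately show thesis using that b by blast
qed

text \<open>If K = bM, then \<open>b\<close> belongs to the colon ideal, so the generators of the
  product already exhaust \<open>K\<close>.\<close>

lemma ideal_smult_colon_ring:
  assumes K: "submodule K R M"
  shows "ideal_smult R M (colon_ring R M K) = K"
proof
  obtain b where b: "b \<in> carrier R" "K = smult_range b" using submodule_eq_smult_range[OF K] .
  then have "b \<in> colon_ring R M K" by (auto simp: colon_ring_def)
  then have "K \<subseteq> {r \<odot>\<^bsub>M\<^esub> m | r m. r \<in> colon_ring R M K \<and> m \<in> carrier M}" using b(2) by blast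
  then show "K \<subseteq> ideal_smult R M (colon_ring R M K)"
    unfolding ideal_smult_def using submodule_span_upper by blast
  show "ideal_smult R M (colon_ring R M K) \<subseteq> K"
    unfolding ideal_smult_def using K by (intro submodule_span_least) (auto simp: colon_ring_def)
qed

section \<open>Second submodules as minimal submodules\<close>

text \<open>Let \<open>T\<close> be the kernel of \<open>a\<close>. If aS = S, a nonzero element of
  \<open>T\<close> would lie in both range and kernel of \<open>a\<close>. So aS = 0, which places
  \<open>S\<close> inside \<open>T\<close>.\<close>

lemma second_submodule_minimal:
  assumes S: "second_submodule R M S" and T: "submodule T R M" "T \<subseteq> S" "T \<noteq> {\<zero>\<^bsub>M\<^esub>}"
  shows "T = S"
proof -
  obtain a where a: "a \<in> carrier R" "T = smult_kernel a" using submodule_eq_smult_kernel[OF T(1)] .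
  have SM: "S \<subseteq> carrier M" using S submodule_carrier by (auto simp: second_submodule_def)
  obtain x where x: "x \<in> T" "x \<noteq> \<zero>\<^bsub>M\<^esub>" using T submodule_zero by blast
  have "(\<lambda>x. a \<odot>\<^bsub>M\<^esub> x) ` S \<noteq> S"
  proof
    assume "(\<lambda>x. a \<odot>\<^bsub>M\<^esub> x) ` S = S"
    then have "x \<in> smult_range a" using x T SM by blast
    then show False using smult_range_Int_kernel[OF a(1)] x a(2) by blast
  qed
  then have "(\<lambda>x. a \<odot>\<^bsub>M\<^esub> x) ` S = {\<zero>\<^bsub>M\<^esub>}" using S a(1) by (auto simp: second_submodule_def)
  then have "S \<subseteq> T" unfolding a(2) smult_kernel_iff subset_iff using SM by blast
  then show ?thesis using T by blast
qed

lemma maximal_second_iff: "maximal_second_submodule R M S \<longleftrightarrow> second_submodule R M S"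
  unfolding maximal_second_submodule_def
  using second_submodule_minimal by (metis second_submodule_def)

text \<open>Otherwise choose \<open>L\<close> maximal among the proper submodules of
  \<open>K\<close> containing the sum. A complement \<open>S\<close> of \<open>L\<close> in
  \<open>K\<close> is minimal, hence second, hence contained in the sum and so in \<open>L\<close>,
  contradicting that \<open>S\<close> meets \<open>L\<close> only in zero.\<close>

lemma maximal_second_sum_eq:
  assumes K: "submodule K R M"
  shows "maximal_second_sum R M K = K"
proof (rule ccontr)
  let ?\<S> = "maximal_second_sum R M K"
  have \<S>K: "?\<S> \<subseteq> K"
    unfolding maximal_second_sum_def submodule_Sum_def
    using K by (intro submodule_span_least) (auto simp: maximal_seconds_in_def)
  have "\<Union>(maximal_seconds_in R M K) \<subseteq> carrier M"
    using submodule_carrier[OF K] by (auto simp: maximal_seconds_in_def)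
  then have \<S>: "submodule ?\<S> R M"
    unfolding maximal_second_sum_def submodule_Sum_def by (rule submodule_span_submodule)
  assume "?\<S> \<noteq> K"
  define \<A> where "\<A> = {L. submodule L R M \<and> ?\<S> \<subseteq> L \<and> L \<subset> K}"
  obtain L where L\<A>: "L \<in> \<A>" and max: "\<And>Z. Z \<in> \<A> \<Longrightarrow> L \<subseteq> Z \<Longrightarrow> Z = L"
    using noetherian_module_has_maximal[OF noetherian, of \<A>] \<open>?\<S> \<noteq> K\<close> \<S> \<S>K unfolding \<A>_def by blast
  then have L: "submodule L R M" "?\<S> \<subseteq> L" "L \<subset> K" by (auto simp: \<A>_def)
  obtain a where a: "a \<in> carrier R" "L = smult_kernel a" using submodule_eq_smult_kernel[OF L(1)] .
  \<comment> \<open>\<open>L\<close> is the kernel of \<open>a\<close>, so aM is a complement of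
    \<open>L\<close> in M; intersecting with \<open>K\<close> gives a complement of \<open>L\<close>
    in \<open>K\<close>, because \<open>L\<close> lies in \<open>K\<close>.\<close>
  define S where "S = K \<inter> smult_range a"
  have S: "submodule S R M"
    unfolding S_def by (rule submodule_Int[OF K smult_range_submodule[OF a(1)]])
  have SL: "x = \<zero>\<^bsub>M\<^esub>" if "x \<in> S" "x \<in> L" for x
    using that smult_range_Int_kernel[OF a(1)] a(2) by (auto simp: S_def)
  have S0: "S \<noteq> {\<zero>\<^bsub>M\<^esub>}"
  proof
    assume S0: "S = {\<zero>\<^bsub>M\<^esub>}"
    obtain k where k: "k \<in> K" "k \<notin> L" using L by blast
    have kM: "k \<in> carrier M" using K k(1) by (rule submodule_carrier)
    obtain m z where mz: "m \<in> carrier M" "z \<in> L" "k = a \<odot>\<^bsub>M\<^esub> m \<oplus>\<^bsub>M\<^esub> z"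
      using smult_range_kernelE[OF a(1) kM] a(2) by blast
    have zM: "z \<in> carrier M" using L(1) mz(2) by (rule submodule_carrier)
    have "a \<odot>\<^bsub>M\<^esub> m = k \<ominus>\<^bsub>M\<^esub> z"
      using mz zM a(1) by (simp add: a_minus_def M.a_assoc M.r_neg)
    then have "a \<odot>\<^bsub>M\<^esub> m \<in> S"
      using submodule_minus[OF K k(1), of z] mz L by (auto simp: S_def)
    then have "k = z" using S0 mz zM by simp
    then show False using k mz by simp
  qed
  have "(\<lambda>x. r \<odot>\<^bsub>M\<^esub> x) ` S = S \<or> (\<lambda>x. r \<odot>\<^bsub>M\<^esub> x) ` S = {\<zero>\<^bsub>M\<^esub>}" if r: "r \<in> carrier R" for r
  proof (rule disjCI)
    let ?T = "(\<lambda>x. r \<odot>\<^bsub>M\<^esub> x) ` S"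
    assume T0: "?T \<noteq> {\<zero>\<^bsub>M\<^esub>}"
    have T: "submodule ?T R M" using S r by (rule smult_image_submodule)
    have TS: "?T \<subseteq> S" using submoduleE(4)[OF S] r by blast
    obtain x where x: "x \<in> ?T" "x \<noteq> \<zero>\<^bsub>M\<^esub>" using T0 submodule_zero[OF T] by blast
    note up = set_add_upper[OF L(1) T]
    \<comment> \<open>The sum of \<open>L\<close> and rS contains the nonzero element
      \<open>x\<close> of \<open>S\<close>, which is not in \<open>L\<close>. By maximality of
      \<open>L\<close> the sum must be \<open>K\<close>.\<close>
    have "L <+>\<^bsub>M\<^esub> ?T \<notin> \<A>" using max[of "L <+>\<^bsub>M\<^esub> ?T"] up x TS SL by blast
    moreover have "L \<subseteq> K" "?T \<subseteq> K" using L(3) TS unfolding S_def by blast+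
    then have "L <+>\<^bsub>M\<^esub> ?T \<subseteq> K"
      using submoduleE(5)[OF K] unfolding set_add_def' by blast
    ultimately have KT: "L <+>\<^bsub>M\<^esub> ?T = K"
      using submodule_add[OF L(1) T] up L(2) unfolding \<A>_def by blast
    \<comment> \<open>Modular law: for s = l + t, the difference s - t = l lies in both
      \<open>S\<close> and \<open>L\<close>, so it vanishes.\<close>
    have "S \<subseteq> ?T"
    proof
      fix s assume s: "s \<in> S"
      then obtain l t where lt: "l \<in> L" "t \<in> ?T" "s = l \<oplus>\<^bsub>M\<^esub> t"
        using KT unfolding S_def set_add_def' by blast
      have c: "l \<in> carrier M" "t \<in> carrier M"
        using lt(1,2) submodule_carrier[OF L(1)] submodule_carrier[OF T] by blast+
      have "l = s \<ominus>\<^bsub>M\<^esub> t" using lt(3) c by (simp add: a_minus_def M.a_assoc M.r_neg)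
      then have "l \<in> S" using submodule_minus[OF S s] lt(2) TS by blast
      then have "l = \<zero>\<^bsub>M\<^esub>" using SL lt(1) by blast
      then have "s = t" using lt(3) c by simp
      then show "s \<in> ?T" using lt(2) by simp
    qed
    then show "?T = S" using TS by blast
  qed
  then have "S \<in> maximal_seconds_in R M K"
    using S S0 by (auto simp: maximal_seconds_in_def maximal_second_iff second_submodule_def S_def)
  then have "S \<subseteq> ?\<S>"
    unfolding maximal_second_sum_def submodule_Sum_def using submodule_span_upper by blast
  then show False using L(2) SL S0 submodule_zero[OF S] by blast
qed

end

section \<open>Annihilators and prime ideals\<close>

context module
begin

lemma ann_in_ring_ideal:
  assumes "submodule N R M"
  shows "ideal (ann_in_ring R M N) R"
proof (rule idealI)
  note c = submodule_carrier[OF assms]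
  show "ring R" by (rule R.ring_axioms)
  show "subgroup (ann_in_ring R M N) (add_monoid R)"
    using c by unfold_locales
      (auto simp: ann_in_ring_def smult_l_distr smult_l_minus simp flip: a_inv_def)
  show "x \<otimes>\<^bsub>R\<^esub> a \<in> ann_in_ring R M N" if "a \<in> ann_in_ring R M N" "x \<in> carrier R" for a x
    using that c by (auto simp: ann_in_ring_def smult_assoc1)
  then show "a \<otimes>\<^bsub>R\<^esub> x \<in> ann_in_ring R M N" if "a \<in> ann_in_ring R M N" "x \<in> carrier R" for a x
    using that by (simp add: R.m_comm ann_in_ring_def)
qed

lemma ann_in_ring_proper:
  assumes "submodule N R M" and "N \<noteq> {\<zero>\<^bsub>M\<^esub>}"
  shows "\<one>\<^bsub>R\<^esub> \<notin> ann_in_ring R M N"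
proof -
  obtain x where "x \<in> N" "x \<noteq> \<zero>\<^bsub>M\<^esub>" using assms submodule_zero by blast
  then show ?thesis using submodule_carrier[OF assms(1)] by (auto simp: ann_in_ring_def)
qed

text \<open>Suppose ab kills \<open>S\<close>. If bS = S, then aS = abS = 0; the only other case is
  bS = 0.\<close>

lemma second_submodule_ann_prime:
  assumes "second_submodule R M S"
  shows "primeideal (ann_in_ring R M S) R"
proof (rule primeidealI)
  have S: "submodule S R M" "S \<noteq> {\<zero>\<^bsub>M\<^esub>}" using assms by (auto simp: second_submodule_def)
  show "ideal (ann_in_ring R M S) R" using S(1) by (rule ann_in_ring_ideal)
  show "cring R" by (rule R.is_cring)
  show "carrier R \<noteq> ann_in_ring R M S" using ann_in_ring_proper[OF S] by blast
  fix a b assume ab: "a \<in> carrier R" "b \<in> carrier R" "a \<otimes>\<^bsub>R\<^esub> b \<in> ann_in_ring R M S"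
  consider "(\<lambda>x. b \<odot>\<^bsub>M\<^esub> x) ` S = S" | "(\<lambda>x. b \<odot>\<^bsub>M\<^esub> x) ` S = {\<zero>\<^bsub>M\<^esub>}"
    using assms ab(2) by (auto simp: second_submodule_def)
  then show "a \<in> ann_in_ring R M S \<or> b \<in> ann_in_ring R M S"
  proof cases
    case 1
    have "a \<odot>\<^bsub>M\<^esub> x = \<zero>\<^bsub>M\<^esub>" if x: "x \<in> S" for x
    proof -
      obtain y where "y \<in> S" "x = b \<odot>\<^bsub>M\<^esub> y" using 1 x by blast
      then show ?thesis
        using ab submodule_carrier[OF S(1)] by (simp add: ann_in_ring_def flip: smult_assoc1)
    qed
    then show ?thesis using ab by (simp add: ann_in_ring_def)
  next
    case 2
    then show ?thesis using ab by (auto simp: ann_in_ring_def)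
  qed
qed

end

lemma (in noetherian_coreduced_comultiplication_module) strong_z_ideal_ann_in_ring:
  assumes N: "submodule N R M" and N0: "N \<noteq> {\<zero>\<^bsub>M\<^esub>}"
  shows "strong_z_ideal R (ann_in_ring R M N)"
  unfolding strong_z_ideal_def
proof (intro conjI allI impI subsetI)
  show "ideal (ann_in_ring R M N) R" using N by (rule ann_in_ring_ideal)
  show "ann_in_ring R M N \<noteq> carrier R" using ann_in_ring_proper[OF N N0] R.one_closed by blast
  fix J x assume J: "J \<subseteq> ann_in_ring R M N" and x: "x \<in> minimal_primes_Inter R J"
  have xR: "x \<in> carrier R" using x by (simp add: minimal_primes_Inter_def)
  have "S \<subseteq> smult_kernel x" if S: "S \<in> maximal_seconds_in R M N" for S
  proof -
    have sec: "second_submodule R M S" and SN: "S \<subseteq> N"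
      using S by (auto simp: maximal_seconds_in_def maximal_second_iff)
    have "J \<subseteq> ann_in_ring R M S" using J SN by (auto simp: ann_in_ring_def)
    then obtain Q where "minimal_prime_containing R J Q" "Q \<subseteq> ann_in_ring R M S"
      using R.minimal_prime_containing_below[OF second_submodule_ann_prime[OF sec]] by blast
    then have "x \<in> ann_in_ring R M S" using x by (auto simp: minimal_primes_Inter_def)
    then show ?thesis using SN submodule_carrier[OF N] by (auto simp: ann_in_ring_def smult_kernel_iff)
  qed
  \<comment> \<open>The kernel of \<open>x\<close> is a submodule, so containing every second
    submodule of \<open>N\<close> it contains their sum, which is \<open>N\<close>.\<close>
  then have "maximal_second_sum R M N \<subseteq> smult_kernel x"
    unfolding maximal_second_sum_def submodule_Sum_def
    using smult_kernel_submodule[OF xR] by (intro submodule_span_least) auto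
  then show "x \<in> ann_in_ring R M N"
    using xR maximal_second_sum_eq[OF N] by (auto simp: ann_in_ring_def smult_kernel_iff)
qed

theorem corollary3p12:
  fixes R :: "('a, 'm) ring_scheme"
    and M :: "('a, 'b, 'n) module_scheme"
    and N :: "'b set"
  assumes "module R M"
    and "noetherian_module R M"
    and "coreduced_module R M"
    and "comultiplication_module R M"
    and "submodule N R M"
    and "N \<noteq> {\<zero>\<^bsub>M\<^esub>}"
  shows
    "(dsz_submodule R M N \<longleftrightarrow>
       (\<exists>\<S>. (\<forall>S \<in> \<S>. maximal_second_submodule R M S) \<and> N = submodule_Sum R M \<S>)) \<and>
     (dsz_submodule R M N \<longleftrightarrow> strong_z_ideal R (ann_in_ring R M N)) \<and>
     (dsz_submodule R M N \<longleftrightarrow>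
       (\<forall>K H. submodule K R M \<longrightarrow> submodule H R M \<longrightarrow>
          maximal_second_sum R M K = maximal_second_sum R M H \<longrightarrow> N \<subseteq> K \<longrightarrow> N \<subseteq> H)) \<and>
     (dsz_submodule R M N \<longleftrightarrow>
       (\<forall>K H. submodule K R M \<longrightarrow> submodule H R M \<longrightarrow>
          maximal_seconds_in R M K = maximal_seconds_in R M H \<longrightarrow> N \<subseteq> K \<longrightarrow> N \<subseteq> H)) \<and>
     (dsz_submodule R M N \<longleftrightarrow>
       (\<forall>K H. submodule K R M \<longrightarrow> submodule H R M \<longrightarrow>
          maximal_seconds_in R M K \<subseteq> maximal_seconds_in R M H \<longrightarrow> N \<subseteq> K \<longrightarrow> N \<subseteq> H)) \<and>
     (dsz_submodule R M N \<longleftrightarrow>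
       (\<forall>K H. submodule K R M \<longrightarrow> submodule H R M \<longrightarrow>
          colon_ring R M K = colon_ring R M H \<longrightarrow> N \<subseteq> K \<longrightarrow> N \<subseteq> H)) \<and>
     (dsz_submodule R M N \<longleftrightarrow>
       (\<forall>K. submodule K R M \<longrightarrow> N \<subseteq> K \<longrightarrow> N \<subseteq> ideal_smult R M (colon_ring R M K)))"
proof -
  interpret noetherian_coreduced_comultiplication_module R M
    using assms(1-4) by (intro noetherian_coreduced_comultiplication_module.intro
      noetherian_coreduced_comultiplication_module_axioms.intro)
  \<comment> \<open>The sum is monotone in the family and recovers each submodule, so inclusion of
    the families already gives inclusion of the submodules. Conditions (e) and (f) follow.\<close>
  have sum_subset: "K \<subseteq> H"
    if "submodule K R M" "submodule H R M" "maximal_seconds_in R M K \<subseteq> maximal_seconds_in R M H" for K H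
  proof -
    have "maximal_second_sum R M K \<subseteq> maximal_second_sum R M H"
      unfolding maximal_second_sum_def submodule_Sum_def submodule_span_def
      using that(3) by (intro hull_mono) blast
    then show ?thesis using that by (simp add: maximal_second_sum_eq)
  qed
  have a: "dsz_submodule R M N"
    using assms(5,6) by (simp add: dsz_submodule_def maximal_second_sum_eq)
  have b: "\<exists>\<T>. (\<forall>S \<in> \<T>. maximal_second_submodule R M S) \<and> N = submodule_Sum R M \<T>"
    using maximal_second_sum_eq[OF assms(5)]
    by (intro exI[of _ "maximal_seconds_in R M N"])
      (auto simp: maximal_second_sum_def maximal_seconds_in_def)
  have c: "strong_z_ideal R (ann_in_ring R M N)"
    using assms(5,6) by (rule strong_z_ideal_ann_in_ring)
  have d: "\<forall>K H. submodule K R M \<longrightarrow> submodule H R M \<longrightarrow>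
      maximal_second_sum R M K = maximal_second_sum R M H \<longrightarrow> N \<subseteq> K \<longrightarrow> N \<subseteq> H"
    by (simp add: maximal_second_sum_eq)
  have f: "\<forall>K H. submodule K R M \<longrightarrow> submodule H R M \<longrightarrow>
      maximal_seconds_in R M K \<subseteq> maximal_seconds_in R M H \<longrightarrow> N \<subseteq> K \<longrightarrow> N \<subseteq> H"
    using sum_subset by blast
  then have e: "\<forall>K H. submodule K R M \<longrightarrow> submodule H R M \<longrightarrow>
      maximal_seconds_in R M K = maximal_seconds_in R M H \<longrightarrow> N \<subseteq> K \<longrightarrow> N \<subseteq> H"
    by blast
  have g: "\<forall>K H. submodule K R M \<longrightarrow> submodule H R M \<longrightarrow>
      colon_ring R M K = colon_ring R M H \<longrightarrow> N \<subseteq> K \<longrightarrow> N \<subseteq> H"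
  proof (intro allI impI)
    fix K H assume KH: "submodule K R M" "submodule H R M" "colon_ring R M K = colon_ring R M H" "N \<subseteq> K"
    \<comment> \<open>A submodule is determined by its colon ideal, being recovered as the product
      of that ideal with M.\<close>
    have "ideal_smult R M (colon_ring R M K) = ideal_smult R M (colon_ring R M H)"
      by (simp only: KH(3))
    then have "K = H" by (simp only: ideal_smult_colon_ring[OF KH(1)] ideal_smult_colon_ring[OF KH(2)])
    then show "N \<subseteq> H" using KH(4) by (simp only:)
  qed
  have h: "\<forall>K. submodule K R M \<longrightarrow> N \<subseteq> K \<longrightarrow> N \<subseteq> ideal_smult R M (colon_ring R M K)"
    by (simp add: ideal_smult_colon_ring)
  show ?thesis by (intro conjI; rule iffI; (rule a b c d e f g h | assumption))
qed

end
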